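(* Let $\mathcal{S}_3$ be the set of integer solutions, identified up to permutation of coordinates, of $(x_1+x_2+x_3)^2-(x_1+x_2+x_3)-4(x_1x_2+x_1x_3+x_2x_3)=0$, and let $\mathcal{F}_3\subseteq\mathcal{S}_3$ be the subset of solutions with all coordinates non-negative. For $k\ge 0$ let $\mathcal{S}_3(k)$ and $\mathcal{F}_3(k)$ be the sets of elements of $\mathcal{S}_3$, respectively $\mathcal{F}_3$, of Euclidean norm at most $k$. Then there exist positive constants $c_1,c_2$ such that $c_1k\le|\mathcal{S}_3(k)|\le c_2k$ for all sufficiently large $k$, i.e. $|\mathcal{S}_3(k)|=\Theta(k)$; similarly $|\mathcal{F}_3(k)|=\Theta(k)$. *)

theory Defs
  imports Complex_Main "HOL-Library.Multiset" "HOL-Library.Landau_Symbols"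
begin

definition is_solution :: "int \<Rightarrow> int \<Rightarrow> int \<Rightarrow> bool" where
  "is_solution x1 x2 x3 \<longleftrightarrow>
     (x1 + x2 + x3)\<^sup>2 - (x1 + x2 + x3) - 4 * (x1 * x2 + x1 * x3 + x2 * x3) = 0"

(* Two triples agree up to a permutation of coordinates iff the multisets of their
   entries coincide, so a solution up to permutation is a multiset. *)
definition S3 :: "int multiset set" where
  "S3 = {{#x1, x2, x3#} | x1 x2 x3. is_solution x1 x2 x3}"

definition F3 :: "int multiset set" where
  "F3 = {M \<in> S3. \<forall>x\<in>#M. 0 \<le> x}"

(* Euclidean norm of any triple whose entries, with multiplicity, form the multiset. *)
definition euclidean_norm :: "int multiset \<Rightarrow> real" where
  "euclidean_norm M = sqrt (\<Sum>x\<in>#M. (real_of_int x)\<^sup>2)"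

definition S3_ball :: "real \<Rightarrow> int multiset set" where
  "S3_ball k = {M \<in> S3. euclidean_norm M \<le> k}"

definition F3_ball :: "real \<Rightarrow> int multiset set" where
  "F3_ball k = {M \<in> F3. euclidean_norm M \<le> k}"

end

theory Submission
  imports Defs
begin

text \<open>
  With $a = 2 x_1 + 1$, $b = 2 x_2 + 1$ and $x = x_1 + x_2 - x_3$ the equation becomes
  $a b = x^2 + x + 1$. Hence all coordinates of a solution have the same sign, the reflection
  $v \mapsto -1 - v$ exchanges the two signs, and a non-negative solution with largest
  coordinate $x_1$ amounts to a root $x$ of $x^2 + x + 1$ modulo $a$ with $0 \le x < a$, up to the
  exchange of $x_2$ and $x_3$, which is $x \mapsto a - 1 - x$. Reduction theory for
  discriminant $-3$ identifies such roots with primitive representations of $a$ by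
  $p^2 + p q + q^2$, and there are $\Theta(A)$ of these with $a \le A$.
\<close>

section \<open>The factored equation and the polynomial \<open>x\<^sup>2 + x + 1\<close>\<close>

lemma is_solution_iff:
  "is_solution x y z \<longleftrightarrow> (2 * x + 1) * (2 * y + 1) = (x + y - z)\<^sup>2 + (x + y - z) + 1"
  unfolding is_solution_def by (auto simp: power2_eq_square algebra_simps)

lemma is_solution_swap12: "is_solution x y z \<Longrightarrow> is_solution y x z"
  and is_solution_swap23: "is_solution x y z \<Longrightarrow> is_solution x z y"
  unfolding is_solution_def by (simp_all add: algebra_simps)

lemma root_poly_pos: "0 < x\<^sup>2 + x + (1 :: int)"
proof -
  have "0 \<le> (2 * x + 1)\<^sup>2" by simp
  then show ?thesis by (simp add: power2_eq_square algebra_simps)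
qed

text \<open>From \<open>x \<le> a - 1\<close> the left side is at most \<open>a * a - a + 1\<close>.
  At \<open>a = 1\<close>, \<open>x = 0\<close> both sides are 1, hence the assumption
  \<open>1 < a\<close>.\<close>

lemma root_poly_less:
  fixes x a :: int
  assumes "0 \<le> x" "x < a" "1 < a"
  shows "x\<^sup>2 + x + 1 < a * a"
proof -
  have "x * (x + 1) \<le> (a - 1) * a"
    using assms by (intro mult_mono) auto
  then show ?thesis
    using assms by (simp add: power2_eq_square algebra_simps)
qed

section \<open>The Eisenstein norm form and unimodular matrices\<close>

text \<open>The form is the norm of the Eisenstein integer \<open>p - q * \<omega>\<close>, with
  \<omega> a primitive cube root of unity. Multiplying by the conjugate of
  \<open>r - s * \<omega>\<close> gives a value of the same form at
  \<open>p * r + q * r + q * s\<close> and the determinant \<open>p * s - q * r\<close>; determinant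
  1 leaves the root polynomial.\<close>

lemma norm_form_mult:
  fixes p q r s :: int
  assumes "p * s - q * r = 1"
  shows "(p\<^sup>2 + p * q + q\<^sup>2) * (r\<^sup>2 + r * s + s\<^sup>2)
       = (p * r + q * r + q * s)\<^sup>2 + (p * r + q * r + q * s) + 1"
proof -
  have "(p\<^sup>2 + p * q + q\<^sup>2) * (r\<^sup>2 + r * s + s\<^sup>2)
      = (p * r + q * r + q * s)\<^sup>2 + (p * r + q * r + q * s) * (p * s - q * r) + (p * s - q * r)\<^sup>2"
    by algebra
  then show ?thesis by (simp add: assms)
qed

text \<open>
  Descent on $a$: after reducing $x$ modulo $a$, the cofactor $b = (x^2 + x + 1) / a$ is smaller
  than $a$ and has the conjugate root $-1 - x$.
\<close>

lemma root_from_unimodular: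
  fixes a x :: int
  assumes "0 < a" "a dvd x\<^sup>2 + x + 1"
  shows "\<exists>p q r s. p * s - q * r = 1 \<and> p\<^sup>2 + p * q + q\<^sup>2 = a \<and> p * r + q * r + q * s = x"
  using assms
proof (induction "nat a" arbitrary: a x rule: less_induct)
  case less
  show ?case
  proof (cases "a = 1")
    case True
    then show ?thesis
      by (intro exI[of _ 1] exI[of _ 0] exI[of _ x]) auto
  next
    case False
    with less.prems have a: "1 < a" by simp
    define y k where "y = x mod a" and "k = x div a"
    have x: "x = y + k * a" by (simp add: y_def k_def)
    have y: "0 \<le> y" "y < a" using a by (auto simp: y_def)
    have "x\<^sup>2 + x + 1 = (y\<^sup>2 + y + 1) + a * (k * (2 * y + k * a + 1))"
      unfolding x by (simp add: power2_eq_square algebra_simps)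
    with less.prems(2) have "a dvd y\<^sup>2 + y + 1"
      by (metis dvd_add_left_iff dvd_triv_left)
    then obtain b where b: "y\<^sup>2 + y + 1 = a * b" by blast
    have "0 < b" using b root_poly_pos[of y] a by (simp add: zero_less_mult_iff)
    have "b < a" using root_poly_less[OF y a] b a by simp
    have conj: "(- 1 - y)\<^sup>2 + (- 1 - y) + 1 = b * a"
      using b by (simp add: power2_eq_square algebra_simps)
    then have "b dvd (- 1 - y)\<^sup>2 + (- 1 - y) + 1" by simp
    with less.hyps[of b "- 1 - y"] \<open>0 < b\<close> \<open>b < a\<close> obtain p q r s where
      pqrs: "p * s - q * r = 1" "p\<^sup>2 + p * q + q\<^sup>2 = b" "p * r + q * r + q * s = - 1 - y"
      by auto
    have "b * (r\<^sup>2 + r * s + s\<^sup>2) = b * a"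
      using norm_form_mult[OF pqrs(1)] pqrs conj by simp
    then have a_eq: "r\<^sup>2 + r * s + s\<^sup>2 = a" using \<open>0 < b\<close> by simp
    \<comment> \<open>The rows of the matrix for \<open>b\<close> are exchanged with one sign
      change, which keeps the determinant and turns the root \<open>- 1 - y\<close> into
      \<open>y\<close>. Then \<open>k\<close> times the new first row is added to the second, which
      shifts the root by \<open>k * a\<close>.\<close>
    have "r * (k * s - q) - s * (k * r - p) = 1"
      using pqrs(1) by (simp add: algebra_simps)
    moreover have "r * (k * r - p) + s * (k * r - p) + s * (k * s - q) = x"
      using pqrs(1,3) a_eq unfolding x by (simp add: power2_eq_square algebra_simps) algebra
    ultimately show ?thesis using a_eq by blast
  qed
qed

section \<open>Upper bound for the number of roots\<close>

definition roots_upto :: "int \<Rightarrow> (int \<times> int) set" where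
  "roots_upto A = {(a, x). 0 < a \<and> a \<le> A \<and> 0 \<le> x \<and> x < a \<and> a dvd x\<^sup>2 + x + 1}"

lemma finite_roots_upto [simp]: "finite (roots_upto A)"
  by (rule finite_subset[of _ "{0..A} \<times> {0..A}"]) (auto simp: roots_upto_def)

text \<open>Completing the square as \<open>3 * p\<^sup>2 + (p + 2 * q)\<^sup>2\<close>, and
  symmetrically in \<open>q\<close>, confines both coordinates to \<open>{-M..M}\<close>. The
  condition on \<open>M\<close> is an integer form of
  \<open>sqrt (4 * A / 3) < M + 1\<close>.\<close>

lemma finite_norm_form_le: "finite {(p :: int, q). p\<^sup>2 + p * q + q\<^sup>2 \<le> A}"
  and card_norm_form_le:
  "0 \<le> M \<Longrightarrow> 4 * A < 3 * (M + 1)\<^sup>2 \<Longrightarrow>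
     int (card {(p :: int, q). p\<^sup>2 + p * q + q\<^sup>2 \<le> A}) \<le> (2 * M + 1)\<^sup>2"
proof -
  let ?S = "{(p :: int, q). p\<^sup>2 + p * q + q\<^sup>2 \<le> A}"
  have sub: "?S \<subseteq> {-M..M} \<times> {-M..M}" if M: "0 \<le> M" "4 * A < 3 * (M + 1)\<^sup>2" for M
  proof -
    have bound: "\<bar>p\<bar> \<le> M" if "p\<^sup>2 + p * q + q\<^sup>2 \<le> A" for p q :: int
    proof -
      have "4 * (p\<^sup>2 + p * q + q\<^sup>2) = 3 * p\<^sup>2 + (p + 2 * q)\<^sup>2" by algebra
      then have "3 * p\<^sup>2 \<le> 4 * (p\<^sup>2 + p * q + q\<^sup>2)" by simp
      with that M(2) have "\<bar>p\<bar>\<^sup>2 < (M + 1)\<^sup>2" by simp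
      then have "\<bar>p\<bar> < M + 1" by (rule power2_less_imp_less) (use M in simp)
      then show ?thesis by simp
    qed
    show ?thesis
    proof clarify
      fix p q :: int assume *: "p\<^sup>2 + p * q + q\<^sup>2 \<le> A"
      then have "q\<^sup>2 + q * p + p\<^sup>2 \<le> A" by (simp add: algebra_simps)
      from bound[OF *] bound[OF this] show "p \<in> {-M..M} \<and> q \<in> {-M..M}" by auto
    qed
  qed
  \<comment> \<open>Finiteness comes without a given bound; \<open>\<bar>4 * A\<bar>\<close> is a
    crude choice of \<open>M\<close> that always works.\<close>
  have "4 * A < 3 * (\<bar>4 * A\<bar> + 1)\<^sup>2"
  proof -
    have "\<bar>4 * A\<bar> + 1 \<le> (\<bar>4 * A\<bar> + 1)\<^sup>2" by (rule self_le_power) auto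
    then show ?thesis by linarith
  qed
  from finite_subset[OF sub[OF _ this]] show "finite ?S" by simp
  assume M: "0 \<le> M" "4 * A < 3 * (M + 1)\<^sup>2"
  have "card ?S \<le> card ({-M..M} \<times> {-M..M})"
    by (rule card_mono[OF _ sub[OF M]]) simp
  also have "\<dots> = (nat (2 * M + 1))\<^sup>2"
    by (simp add: card_cartesian_product power2_eq_square)
  finally have "int (card ?S) \<le> int ((nat (2 * M + 1))\<^sup>2)" by (rule of_nat_mono)
  also have "\<dots> = (2 * M + 1)\<^sup>2" using M(1) by simp
  finally show "int (card ?S) \<le> (2 * M + 1)\<^sup>2" .
qed

text \<open>Two completions of \<open>(p, q)\<close> to determinant 1 differ by a multiple of the
  first row, and such a change moves the root by a multiple of the form. So the first row alone
  fixes the root modulo \<open>a\<close>.\<close>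

lemma dvd_root_diff:
  fixes p q r s r' s' :: int
  assumes "p * s - q * r = 1" "p * s' - q * r' = 1"
  shows "p\<^sup>2 + p * q + q\<^sup>2 dvd (p * r + q * r + q * s) - (p * r' + q * r' + q * s')"
proof -
  have "(p * r + q * r + q * s) - (p * r' + q * r' + q * s')
      = (p\<^sup>2 + p * q + q\<^sup>2) * (s * (r - r') - r * (s - s'))"
    using assms by algebra
  then show ?thesis by simp
qed

text \<open>Sending each root to the first row of a matrix for it is injective: the form at that row
  recovers \<open>a\<close>, the row fixes \<open>x\<close> modulo \<open>a\<close>, and
  \<open>0 \<le> x < a\<close> then fixes \<open>x\<close>.\<close>

lemma card_roots_upto_le: "card (roots_upto A) \<le> card {(p :: int, q). p\<^sup>2 + p * q + q\<^sup>2 \<le> A}"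
proof -
  define R where "R = (\<lambda>u v. case u of (a, x) \<Rightarrow> case v of (p, q) \<Rightarrow>
    p\<^sup>2 + p * q + q\<^sup>2 = a \<and> (\<exists>r s :: int. p * s - q * r = 1 \<and> p * r + q * r + q * s = x))"
  have "\<forall>u\<in>roots_upto A. \<exists>v. R u v"
    unfolding roots_upto_def R_def using root_from_unimodular by fastforce
  then obtain g where g: "\<And>u. u \<in> roots_upto A \<Longrightarrow> R u (g u)"
    by metis
  have "inj_on g (roots_upto A)"
  proof (rule inj_onI, clarify)
    fix a x a' x'
    assume in_roots: "(a, x) \<in> roots_upto A" "(a', x') \<in> roots_upto A"
      and eq: "g (a, x) = g (a', x')"
    obtain p q where pq: "g (a, x) = (p, q)" by force
    from g[OF in_roots(1)] g[OF in_roots(2)] have a: "a' = a" "a dvd x - x'"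
      using dvd_root_diff unfolding R_def pq eq[symmetric] by auto
    then have "x mod a = x' mod a" by (simp add: mod_eq_dvd_iff)
    then show "a = a' \<and> x = x'" using in_roots a by (auto simp: roots_upto_def)
  qed
  moreover have "g ` roots_upto A \<subseteq> {(p, q). p\<^sup>2 + p * q + q\<^sup>2 \<le> A}"
    using g by (fastforce simp: R_def roots_upto_def)
  ultimately show ?thesis
    by (rule card_inj_on_le) (rule finite_norm_form_le)
qed

section \<open>Density of coprime pairs\<close>

text \<open>Each new term is at most \<open>1 / n - 1 / (n + 1)\<close>, so the sum telescopes from
  the exact value 1/4 at \<open>n = 2\<close>. What matters later is that 3/4 is below 1.\<close>

lemma sum_inverse_squares_le:
  "2 \<le> n \<Longrightarrow> (\<Sum>d=2..n. 1 / (real d)\<^sup>2) \<le> 3 / 4 - 1 / real n"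
proof (induction n rule: dec_induct)
  case base
  show ?case by simp
next
  case (step n)
  then have "(\<Sum>d=2..Suc n. 1 / (real d)\<^sup>2) = (\<Sum>d=2..n. 1 / (real d)\<^sup>2) + 1 / (real (Suc n))\<^sup>2"
    by simp
  also have "1 / (real (Suc n))\<^sup>2 \<le> 1 / (real n * real (Suc n))"
    using step.hyps by (intro divide_left_mono) (auto simp: power2_eq_square)
  also have "\<dots> = 1 / real n - 1 / real (Suc n)"
    using step.hyps by (simp add: field_simps)
  finally show ?case using step.IH by simp
qed

definition coprime_pairs :: "nat \<Rightarrow> (nat \<times> nat) set" where
  "coprime_pairs n = {(p, q) \<in> {1..n} \<times> {1..n}. coprime p q}"

lemma finite_coprime_pairs [simp]: "finite (coprime_pairs n)"
  by (rule finite_subset[of _ "{1..n} \<times> {1..n}"]) (auto simp: coprime_pairs_def)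

text \<open>A pair that is not coprime is a multiple of its gcd \<open>d \<ge> 2\<close>. The union
  bound over \<open>d\<close> removes at most 3/4 of the square.\<close>

lemma card_coprime_pairs_ge:
  assumes "2 \<le> n"
  shows "(real n)\<^sup>2 / 4 \<le> real (card (coprime_pairs n))"
proof -
  let ?B = "{1..n} \<times> {1..n}"
  \<comment> \<open>For \<open>d\<close> in \<open>{2..n}\<close> these are the pairs of the square
    with both coordinates divisible by \<open>d\<close>, parametrised by their quotients so that the
    size bound is immediate.\<close>
  define D where "D = (\<lambda>d. (\<lambda>(i, j). (d * i, d * j)) ` ({1..n div d} \<times> {1..n div d}))"
  have "?B \<subseteq> coprime_pairs n \<union> (\<Union>d\<in>{2..n}. D d)"
  proof clarify
    fix p q assume pq: "p \<in> {1..n}" "q \<in> {1..n}" "(p, q) \<notin> (\<Union>d\<in>{2..n}. D d)"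
    define d where "d = gcd p q"
    obtain i j where ij: "p = d * i" "q = d * j"
      unfolding d_def by (meson dvdE gcd_dvd1 gcd_dvd2)
    have "0 < d" "d \<le> n" using pq by (auto simp: d_def intro: order_trans[OF gcd_le1_nat])
    moreover have "i \<in> {1..n div d}" "j \<in> {1..n div d}"
      using pq ij \<open>0 < d\<close> by (auto simp: less_eq_div_iff_mult_less_eq mult.commute Suc_le_eq)
    then have "(p, q) \<in> D d" unfolding D_def ij by auto
    ultimately have "d = 1" using pq(3) by fastforce
    then show "(p, q) \<in> coprime_pairs n"
      using pq by (simp add: coprime_pairs_def d_def coprime_iff_gcd_eq_1)
  qed
  then have "card ?B \<le> card (coprime_pairs n \<union> (\<Union>d\<in>{2..n}. D d))"
    by (intro card_mono) (auto simp: D_def)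
  also have "\<dots> \<le> card (coprime_pairs n) + card (\<Union>d\<in>{2..n}. D d)"
    by (rule card_Un_le)
  also have "card (\<Union>d\<in>{2..n}. D d) \<le> (\<Sum>d=2..n. card (D d))"
    by (rule card_UN_le) simp
  also have "\<dots> \<le> (\<Sum>d=2..n. (n div d)\<^sup>2)"
    unfolding D_def
    by (intro sum_mono order_trans[OF card_image_le])
       (auto simp: card_cartesian_product power2_eq_square)
  finally have "real (n\<^sup>2) \<le> real (card (coprime_pairs n) + (\<Sum>d=2..n. (n div d)\<^sup>2))"
    unfolding of_nat_le_iff by (simp add: card_cartesian_product power2_eq_square)
  also have "\<dots> = real (card (coprime_pairs n)) + (\<Sum>d=2..n. (real (n div d))\<^sup>2)"
    by simp
  also have "(\<Sum>d=2..n. (real (n div d))\<^sup>2) \<le> (\<Sum>d=2..n. (real n)\<^sup>2 * (1 / (real d)\<^sup>2))"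
  proof (rule sum_mono)
    fix d
    have "(real (n div d))\<^sup>2 \<le> (real n / real d)\<^sup>2"
      by (intro power_mono of_nat_div_le_of_nat) auto
    then show "(real (n div d))\<^sup>2 \<le> (real n)\<^sup>2 * (1 / (real d)\<^sup>2)"
      by (simp add: power_divide)
  qed
  also have "\<dots> = (real n)\<^sup>2 * (\<Sum>d=2..n. 1 / (real d)\<^sup>2)"
    by (simp add: sum_distrib_left)
  also have "\<dots> \<le> (real n)\<^sup>2 * (3 / 4)"
    by (intro mult_left_mono order_trans[OF sum_inverse_squares_le[OF assms]]) auto
  finally show ?thesis by simp
qed

section \<open>Lower bound for the number of roots\<close>

text \<open>Bezout completes \<open>(p, q)\<close> to determinant 1, and the resulting root is
  reduced modulo the form. The last divisibility says that \<open>x\<close> is \<open>q / p\<close>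
  modulo the form; it serves to recover the pair from the root.\<close>

lemma ex_root_of_coprime:
  fixes p q :: int
  assumes "coprime p q" "0 < p\<^sup>2 + p * q + q\<^sup>2"
  shows "\<exists>x. 0 \<le> x \<and> x < p\<^sup>2 + p * q + q\<^sup>2 \<and> p\<^sup>2 + p * q + q\<^sup>2 dvd x\<^sup>2 + x + 1
           \<and> p\<^sup>2 + p * q + q\<^sup>2 dvd p * x - q"
proof -
  define a where "a = p\<^sup>2 + p * q + q\<^sup>2"
  obtain s r where "s * p + r * q = 1"
    using assms(1) bezout_int[of p q] by auto
  then have det: "p * s - q * (- r) = 1" by (simp add: algebra_simps)
  define X where "X = p * (- r) + q * (- r) + q * s"
  define x where "x = X mod a"
  have "a dvd X\<^sup>2 + X + 1"
    unfolding a_def X_def norm_form_mult[OF det, symmetric] by simp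
  moreover have "a dvd p * X - q"
  proof -
    have "p * X - q = a * (- r)" unfolding X_def a_def using det by algebra
    then show ?thesis by simp
  qed
  moreover have "a dvd x - X" by (simp add: x_def mod_eq_dvd_iff[symmetric])
  then obtain k where "x = X + a * k" by (metis add.commute diff_eq_eq dvdE)
  then have "x\<^sup>2 + x + 1 = X\<^sup>2 + X + 1 + a * (k * (2 * X + a * k + 1))"
    "p * x - q = p * X - q + a * (p * k)"
    by (simp_all add: power2_eq_square algebra_simps)
  ultimately have "a dvd x\<^sup>2 + x + 1" "a dvd p * x - q"
    by (metis dvd_add dvd_triv_left)+
  moreover have "0 \<le> x" "x < a" using assms(2) by (auto simp: x_def a_def)
  ultimately show ?thesis unfolding a_def by blast
qed

text \<open>On the square the form is at most \<open>3 * n\<^sup>2\<close>. The map to roots is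
  injective because equal roots give \<open>p * q'\<close> and \<open>p' * q\<close> congruent
  modulo \<open>a\<close>, both products lie in \<open>[0, a)\<close>, and coprime pairs with equal
  ratio coincide.\<close>

lemma card_coprime_pairs_le: "card (coprime_pairs n) \<le> card (roots_upto (3 * (int n)\<^sup>2))"
proof -
  define N :: "nat \<times> nat \<Rightarrow> int"
    where "N = (\<lambda>(p, q). (int p)\<^sup>2 + int p * int q + (int q)\<^sup>2)"
  have "\<forall>u\<in>coprime_pairs n. \<exists>x. 0 \<le> x \<and> x < N u \<and> N u dvd x\<^sup>2 + x + 1
          \<and> N u dvd int (fst u) * x - int (snd u)"
  proof clarify
    fix p q assume "(p, q) \<in> coprime_pairs n"
    then have "coprime (int p) (int q)" "0 < (int p)\<^sup>2 + int p * int q + (int q)\<^sup>2"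
      by (auto simp: coprime_pairs_def add_pos_nonneg)
    from ex_root_of_coprime[OF this]
    show "\<exists>x. 0 \<le> x \<and> x < N (p, q) \<and> N (p, q) dvd x\<^sup>2 + x + 1
          \<and> N (p, q) dvd int (fst (p, q)) * x - int (snd (p, q))"
      by (simp add: N_def)
  qed
  then obtain g where g: "\<And>u. u \<in> coprime_pairs n \<Longrightarrow> 0 \<le> g u \<and> g u < N u
      \<and> N u dvd (g u)\<^sup>2 + g u + 1 \<and> N u dvd int (fst u) * g u - int (snd u)"
    by metis
  have "inj_on (\<lambda>u. (N u, g u)) (coprime_pairs n)"
  proof (rule inj_onI, clarify)
    fix p q p' q'
    assume u: "(p, q) \<in> coprime_pairs n" "(p', q') \<in> coprime_pairs n"
      and eq: "N (p, q) = N (p', q')" "g (p, q) = g (p', q')"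
    define a x where "a = N (p, q)" and "x = g (p, q)"
    have pos: "0 < p" "0 < q" "0 < p'" "0 < q'" using u by (auto simp: coprime_pairs_def)
    have "a dvd int p * x - int q" "a dvd int p' * x - int q'"
      using g[OF u(1)] g[OF u(2)] eq by (auto simp: a_def x_def)
    then have "a dvd int p' * (int p * x - int q) - int p * (int p' * x - int q')"
      by (meson dvd_diff dvd_mult)
    then have dvd: "a dvd int p * int q' - int p' * int q"
      by (simp add: algebra_simps)
    have less: "int i * int j < a" if ij: "(int i)\<^sup>2 < a" "(int j)\<^sup>2 < a" for i j
    proof -
      have "int i * int j \<le> (max (int i) (int j))\<^sup>2"
        unfolding power2_eq_square by (intro mult_mono) auto
      also have "\<dots> < a" using ij by (simp add: max_def)
      finally show ?thesis .
    qed
    \<comment> \<open>Since the coordinates are positive, each square is strictly smaller than the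
      form, so the cross products stay below \<open>a\<close>.\<close>
    have "(int p)\<^sup>2 < a" "(int q)\<^sup>2 < a" using pos by (auto simp: a_def N_def add_pos_pos)
    moreover have "(int p')\<^sup>2 < a" "(int q')\<^sup>2 < a"
      using pos unfolding a_def eq(1) by (auto simp: N_def add_pos_pos)
    ultimately have "int p * int q' < a" "int p' * int q < a" by (auto intro: less)
    moreover have "0 \<le> int p * int q'" "0 \<le> int p' * int q" by auto
    ultimately have "\<bar>int p * int q' - int p' * int q\<bar> < \<bar>a\<bar>" by linarith
    with dvd have "int p * int q' - int p' * int q = 0" using dvd_imp_le_int by (meson not_le)
    then have "int (p * q') = int (p' * q)" by simp
    then have prod_eq: "p * q' = p' * q" by (simp only: of_nat_eq_iff)
    have "coprime p q" "coprime p' q'" using u by (auto simp: coprime_pairs_def)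
    moreover have "p dvd p' * q" "p' dvd p * q'" by (simp_all flip: prod_eq) (simp add: prod_eq)
    ultimately have "p dvd p'" "p' dvd p" by (simp_all add: coprime_dvd_mult_left_iff)
    then have "p = p'" by (rule dvd_antisym)
    with prod_eq pos show "p = p' \<and> q = q'" by simp
  qed
  moreover have "(\<lambda>u. (N u, g u)) ` coprime_pairs n \<subseteq> roots_upto (3 * (int n)\<^sup>2)"
  proof clarify
    fix p q assume u: "(p, q) \<in> coprime_pairs n"
    then have "int p \<le> int n" "int q \<le> int n" "0 < p" by (auto simp: coprime_pairs_def)
    then have "int p * int p \<le> int n * int n" "int p * int q \<le> int n * int n"
      "int q * int q \<le> int n * int n" by (auto intro: mult_mono)
    then have "N (p, q) \<le> 3 * (int n)\<^sup>2" by (simp add: N_def power2_eq_square)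
    moreover have "0 < N (p, q)" using \<open>0 < p\<close> by (auto simp: N_def add_pos_nonneg)
    ultimately show "(N (p, q), g (p, q)) \<in> roots_upto (3 * (int n)\<^sup>2)"
      using g[OF u] by (simp add: roots_upto_def)
  qed
  ultimately show ?thesis by (rule card_inj_on_le) simp
qed

section \<open>Correspondence between roots and non-negative solutions\<close>

text \<open>This makes the coordinate belonging to \<open>a\<close> the largest one. The case
  \<open>a = 1\<close> is separate because there \<open>b = a\<close>.\<close>

lemma cofactor_bounds:
  fixes a b x :: int
  assumes "0 \<le> x" "x < a" "a * b = x\<^sup>2 + x + 1"
  shows "0 < b" "b \<le> a"
proof -
  have "0 < a * b" unfolding assms(3) by (rule root_poly_pos)
  then show "0 < b" using assms(1,2) by (simp add: zero_less_mult_iff)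
  show "b \<le> a"
  proof (cases "a = 1")
    case True
    with assms(1,2) have "x = 0" by simp
    with True assms(3) show ?thesis by simp
  next
    case False
    then have "a * b < a * a" using root_poly_less assms by simp
    then show ?thesis using assms(1,2) by simp
  qed
qed

text \<open>Inverts the substitution: \<open>a\<close> and its cofactor are odd, so halving with
  \<open>div\<close> recovers the first two coordinates, and \<open>x = x1 + x2 - x3\<close> gives
  the third.\<close>

definition root_solution :: "int \<times> int \<Rightarrow> int multiset" where
  "root_solution = (\<lambda>(a, x).
    {#a div 2, (x\<^sup>2 + x + 1) div a div 2, a div 2 + (x\<^sup>2 + x + 1) div a div 2 - x#})"

lemma roots_upto_coordinates:
  assumes "(a, x) \<in> roots_upto A"
  obtains m y z where "root_solution (a, x) = {#m, y, z#}" "is_solution m y z"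
    "a = 2 * m + 1" "x = m + y - z" "0 \<le> y" "y \<le> m" "0 \<le> z" "z \<le> m"
proof -
  have ax: "0 \<le> x" "x < a" "a dvd x\<^sup>2 + x + 1" using assms by (auto simp: roots_upto_def)
  then obtain b where b: "a * b = x\<^sup>2 + x + 1" by (metis dvdE)
  \<comment> \<open>One of \<open>x\<close> and \<open>x + 1\<close> is even, so the polynomial is
    odd and so are both factors.\<close>
  have "odd (x\<^sup>2 + x + 1)" by simp
  then have odd: "odd a" "odd b" unfolding b[symmetric] by auto
  define m y z where "m = a div 2" and "y = b div 2" and "z = m + y - x"
  have a: "a = 2 * m + 1" and b': "b = 2 * y + 1"
    using odd by (simp_all add: m_def y_def)
  \<comment> \<open>The root \<open>a - 1 - x\<close> has cofactor \<open>2 * z + 1\<close>, so the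
    bounds already proved for \<open>y\<close> apply to \<open>z\<close> as well.\<close>
  have "0 \<le> a - 1 - x" "a - 1 - x < a" using ax by auto
  moreover have "a * (2 * z + 1) = (a - 1 - x)\<^sup>2 + (a - 1 - x) + 1"
    using b unfolding z_def a b' by (simp add: power2_eq_square algebra_simps)
  ultimately have c: "0 < 2 * z + 1" "2 * z + 1 \<le> a" by (rule cofactor_bounds)+
  have "0 < b" "b \<le> a" using cofactor_bounds[OF ax(1,2) b] .
  with c have "0 \<le> y" "y \<le> m" "0 \<le> z" "z \<le> m" unfolding a b' by auto
  moreover have "is_solution m y z"
    using b unfolding is_solution_iff z_def a b' by simp
  moreover have "root_solution (a, x) = {#m, y, z#}"
    using ax b[symmetric] by (simp add: root_solution_def z_def m_def y_def)
  moreover have "x = m + y - z" by (simp add: z_def)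
  ultimately show ?thesis using that a by blast
qed

text \<open>
  Two roots giving the same solution differ at most by the exchange of $y$ and $z$, and
  $2 x < a$ is equivalent to $y \le z$.
\<close>

lemma card_roots_upto_le_solutions:
  "card (roots_upto A) \<le> 2 * card (root_solution ` roots_upto A)"
proof -
  have "inj_on (\<lambda>(a, x). (root_solution (a, x), 2 * x < a)) (roots_upto A)"
  proof (rule inj_onI, clarify)
    fix a x a' x'
    assume u: "(a, x) \<in> roots_upto A" "(a', x') \<in> roots_upto A"
      and eq: "root_solution (a, x) = root_solution (a', x')" "(2 * x < a) = (2 * x' < a')"
    obtain m y z where 1: "root_solution (a, x) = {#m, y, z#}"
      "a = 2 * m + 1" "x = m + y - z" "y \<le> m" "z \<le> m"
      using roots_upto_coordinates[OF u(1)] by metis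
    obtain m' y' z' where 2: "root_solution (a', x') = {#m', y', z'#}"
      "a' = 2 * m' + 1" "x' = m' + y' - z'" "y' \<le> m'" "z' \<le> m'"
      using roots_upto_coordinates[OF u(2)] by metis
    have ms: "{#m, y, z#} = {#m', y', z'#}" using eq 1 2 by simp
    \<comment> \<open>Each of \<open>m\<close> and \<open>m'\<close> is the maximum of the common
      multiset, so they agree.\<close>
    then have "m \<in># {#m', y', z'#}" "m' \<in># {#m, y, z#}"
      by (metis union_single_eq_member add_mset_add_single)+
    with 1 2 have m: "m = m'" by auto
    with ms have "{#y, z#} = {#y', z'#}" by simp
    then have "y = y' \<and> z = z' \<or> y = z' \<and> z = y'"
      by (auto simp: add_eq_conv_diff split: if_splits)
    moreover have "y \<le> z \<longleftrightarrow> y' \<le> z'" using eq(2) 1 2 by auto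
    ultimately show "a = a' \<and> x = x'" using 1 2 m by auto
  qed
  then have "card (roots_upto A) \<le> card (root_solution ` roots_upto A \<times> (UNIV :: bool set))"
    by (rule card_inj_on_le) auto
  then show ?thesis by (simp add: card_cartesian_product mult.commute)
qed

lemma S3_sorted:
  assumes "M \<in> S3"
  obtains m y z where "M = {#m, y, z#}" "is_solution m y z" "y \<le> m" "z \<le> m"
proof -
  obtain x1 x2 x3 where M: "M = {#x1, x2, x3#}" and sol: "is_solution x1 x2 x3"
    using assms by (auto simp: S3_def)
  consider "x2 \<le> x1" "x3 \<le> x1" | "x1 \<le> x2" "x3 \<le> x2" | "x1 \<le> x3" "x2 \<le> x3" by linarith
  then show ?thesis
  proof cases
    case 1
    then show ?thesis using that M sol by blast
  next
    case 2
    then show ?thesis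
      using that[of x2 x1 x3] M is_solution_swap12[OF sol] by (simp add: add_mset_commute)
  next
    case 3
    then show ?thesis
      using that[of x3 x1 x2] M is_solution_swap12[OF is_solution_swap23[OF sol]]
      by (simp add: add_mset_commute)
  qed
qed

text \<open>Putting the largest coordinate \<open>m\<close> first ensures
  \<open>0 \<le> m + y - z \<le> 2 * m\<close>, so this number is a reduced root modulo
  \<open>2 * m + 1\<close>.\<close>

lemma F3_subset_root_solutions:
  assumes "M \<in> F3" "\<And>x. x \<in># M \<Longrightarrow> x \<le> K"
  shows "M \<in> root_solution ` roots_upto (2 * K + 1)"
proof -
  have "M \<in> S3" using assms(1) by (simp add: F3_def)
  then obtain m y z where M: "M = {#m, y, z#}" and sol: "is_solution m y z"
    and le: "y \<le> m" "z \<le> m"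
    by (rule S3_sorted)
  have nonneg: "0 \<le> m" "0 \<le> y" "0 \<le> z" using assms(1) by (auto simp: F3_def M)
  have "m \<le> K" using assms(2) by (simp add: M)
  define x where "x = m + y - z"
  have prod: "x\<^sup>2 + x + 1 = (2 * m + 1) * (2 * y + 1)"
    using sol by (simp add: is_solution_iff x_def)
  have "(2 * m + 1, x) \<in> roots_upto (2 * K + 1)"
    using nonneg le \<open>m \<le> K\<close> by (auto simp: roots_upto_def prod) (auto simp: x_def)
  moreover have "root_solution (2 * m + 1, x) = M"
    using nonneg by (simp add: root_solution_def prod M) (simp add: x_def)
  ultimately show ?thesis by (metis imageI)
qed

text \<open>Reflection negates every \<open>2 * u + 1\<close> and sends \<open>u + v - w\<close> to
  its conjugate root, so the equation persists. Strict negativity is recorded for the later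
  comparison of norms.\<close>

lemma S3_cases:
  assumes "M \<in> S3"
  shows "M \<in> F3 \<or> image_mset (\<lambda>x. - 1 - x) M \<in> F3 \<and> (\<forall>x\<in>#M. x < 0)"
proof -
  obtain x y z where M: "M = {#x, y, z#}" and sol: "is_solution x y z"
    using assms by (auto simp: S3_def)
  have same_sign: "0 \<le> u \<longleftrightarrow> 0 \<le> v" if "is_solution u v w" for u v w
  proof -
    have "0 < (2 * u + 1) * (2 * v + 1)"
      using that root_poly_pos unfolding is_solution_iff by metis
    then show ?thesis by (auto simp: zero_less_mult_iff)
  qed
  have signs: "0 \<le> x \<longleftrightarrow> 0 \<le> y" "0 \<le> x \<longleftrightarrow> 0 \<le> z"
    using same_sign[OF sol] same_sign[OF is_solution_swap23[OF sol]] .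
  have "is_solution (- 1 - x) (- 1 - y) (- 1 - z)"
    using sol unfolding is_solution_def by (simp add: power2_eq_square algebra_simps)
  then have refl: "image_mset (\<lambda>x. - 1 - x) M \<in> S3" unfolding S3_def M by auto
  show ?thesis
  proof (cases "0 \<le> x")
    case True
    then show ?thesis using assms signs by (auto simp: F3_def M)
  next
    case False
    then show ?thesis using refl signs unfolding F3_def by (auto simp: M)
  qed
qed

section \<open>Counting non-negative solutions in a ball\<close>

lemma member_le_euclidean_norm:
  assumes "x \<in># M"
  shows "\<bar>real_of_int x\<bar> \<le> euclidean_norm M"
proof -
  obtain N where M: "M = add_mset x N" using assms by (metis mset_add)
  have "(real_of_int x)\<^sup>2 \<le> (\<Sum>x\<in>#M. (real_of_int x)\<^sup>2)"
    unfolding M by (induction N) auto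
  then show ?thesis unfolding euclidean_norm_def
    by (metis real_sqrt_abs real_sqrt_le_iff)
qed

lemma F3_ball_subset: "F3_ball k \<subseteq> root_solution ` roots_upto (2 * \<lfloor>k\<rfloor> + 1)"
proof
  fix M assume "M \<in> F3_ball k"
  then have M: "M \<in> F3" "euclidean_norm M \<le> k" by (auto simp: F3_ball_def)
  have "x \<le> \<lfloor>k\<rfloor>" if "x \<in># M" for x
    using member_le_euclidean_norm[OF that] M(2) by (simp add: le_floor_iff)
  with M(1) show "M \<in> root_solution ` roots_upto (2 * \<lfloor>k\<rfloor> + 1)"
    by (rule F3_subset_root_solutions)
qed

lemma finite_F3_ball: "finite (F3_ball k)"
  by (rule finite_subset[OF F3_ball_subset]) simp

lemma card_F3_ball_le:
  assumes "1 \<le> k"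
  shows "real (card (F3_ball k)) \<le> 25 * k"
proof -
  \<comment> \<open>With \<open>A = 2 * \<lfloor>k\<rfloor> + 1\<close> and \<open>1 \<le> k\<close>
    one has \<open>4 * A \<le> 8 * k + 4 \<le> 12 * k < 3 * (L + 1)\<^sup>2\<close>, as the lattice
    point count requires. Then \<open>2 * L + 1 \<le> 5 * sqrt k\<close> yields the constant
    25.\<close>
  define L where "L = \<lfloor>2 * sqrt k\<rfloor>"
  have "0 \<le> L" using assms by (simp add: L_def)
  have "2 * sqrt k < real_of_int (L + 1)" by (simp add: L_def)
  then have "(2 * sqrt k)\<^sup>2 < (real_of_int (L + 1))\<^sup>2"
    using assms by (intro power_strict_mono) auto
  then have "4 * k < real_of_int ((L + 1)\<^sup>2)" using assms by (simp add: power_mult_distrib)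
  moreover have "real_of_int (4 * (2 * \<lfloor>k\<rfloor> + 1)) \<le> 8 * k + 4" by simp
  ultimately have "real_of_int (4 * (2 * \<lfloor>k\<rfloor> + 1)) < real_of_int (3 * (L + 1)\<^sup>2)"
    using assms unfolding of_int_mult[of 3] by linarith
  then have L: "4 * (2 * \<lfloor>k\<rfloor> + 1) < 3 * (L + 1)\<^sup>2" unfolding of_int_less_iff .
  have "card (F3_ball k) \<le> card (root_solution ` roots_upto (2 * \<lfloor>k\<rfloor> + 1))"
    by (intro card_mono F3_ball_subset) simp
  also have "\<dots> \<le> card (roots_upto (2 * \<lfloor>k\<rfloor> + 1))" by (intro card_image_le) simp
  also note card_roots_upto_le
  finally have "int (card (F3_ball k)) \<le> (2 * L + 1)\<^sup>2"
    using card_norm_form_le[OF \<open>0 \<le> L\<close> L] by linarith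
  then have "real (card (F3_ball k)) \<le> (real_of_int (2 * L + 1))\<^sup>2"
    by (metis of_int_le_iff of_int_of_nat_eq of_int_power)
  also have "\<dots> \<le> (5 * sqrt k)\<^sup>2"
  proof (rule power_mono)
    have "real_of_int L \<le> 2 * sqrt k" by (simp add: L_def)
    moreover have "1 \<le> sqrt k" using assms by simp
    ultimately show "real_of_int (2 * L + 1) \<le> 5 * sqrt k" by linarith
  qed (use \<open>0 \<le> L\<close> in simp)
  also have "\<dots> = 25 * k" using assms by (simp add: power_mult_distrib)
  finally show ?thesis .
qed

text \<open>The norm is at most \<open>sqrt 3 * m\<close>, rounded up to \<open>3 * m\<close>, and
  \<open>2 * m + 1 \<le> A\<close>.\<close>

lemma root_solutions_subset_F3_ball:
  assumes "3 * real_of_int A \<le> 2 * k"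
  shows "root_solution ` roots_upto A \<subseteq> F3_ball k"
proof clarify
  fix a x assume u: "(a, x) \<in> roots_upto A"
  then obtain m y z where *: "root_solution (a, x) = {#m, y, z#}" "is_solution m y z"
    "a = 2 * m + 1" "0 \<le> y" "y \<le> m" "0 \<le> z" "z \<le> m"
    by (metis roots_upto_coordinates)
  have "{#m, y, z#} \<in> F3" using * by (auto simp: F3_def S3_def)
  moreover have "euclidean_norm {#m, y, z#} \<le> k"
  proof -
    have "2 * m + 1 \<le> A" using u * by (simp add: roots_upto_def)
    then have "2 * real_of_int m + 1 \<le> real_of_int A" by linarith
    then have k: "3 * real_of_int m \<le> k" using assms by linarith
    have sq: "(real_of_int y)\<^sup>2 \<le> (real_of_int m)\<^sup>2" "(real_of_int z)\<^sup>2 \<le> (real_of_int m)\<^sup>2"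
      using * by (auto intro!: power_mono)
    have "(real_of_int m)\<^sup>2 + ((real_of_int y)\<^sup>2 + (real_of_int z)\<^sup>2) \<le> (3 * real_of_int m)\<^sup>2"
      using sq unfolding power_mult_distrib by (simp, use zero_le_power2[of "real_of_int m"] in linarith)
    then have "euclidean_norm {#m, y, z#} \<le> 3 * real_of_int m"
      using * by (auto simp: euclidean_norm_def intro!: real_le_lsqrt)
    with k show ?thesis by simp
  qed
  ultimately show "root_solution (a, x) \<in> F3_ball k" by (simp add: *(1) F3_ball_def)
qed

lemma card_F3_ball_ge:
  assumes "81 \<le> k"
  shows "k / 288 \<le> real (card (F3_ball k))"
proof -
  \<comment> \<open>This \<open>n\<close> gives \<open>9 * n\<^sup>2 \<le> k\<close>, enough for the
    roots up to \<open>3 * n\<^sup>2\<close> to land in the ball. For \<open>81 \<le> k\<close> the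
    floor loses at most half, so \<open>n\<^sup>2 / 4 \<ge> k / 144\<close>; the two-to-one map from
    roots to solutions halves this to \<open>k / 288\<close>.\<close>
  define n where "n = nat \<lfloor>sqrt k / 3\<rfloor>"
  have "9 \<le> sqrt k" using assms by (intro real_le_rsqrt) simp
  then have "0 \<le> \<lfloor>sqrt k / 3\<rfloor>" by linarith
  then have n_real: "real n = real_of_int \<lfloor>sqrt k / 3\<rfloor>" by (simp add: n_def of_nat_nat)
  then have n: "real n \<le> sqrt k / 3" "sqrt k / 6 \<le> real n"
    using \<open>9 \<le> sqrt k\<close> by linarith+
  have "2 \<le> n" using n_real \<open>9 \<le> sqrt k\<close> by linarith
  have "(real n)\<^sup>2 \<le> (sqrt k / 3)\<^sup>2" using n(1) by (intro power_mono) auto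
  then have "3 * real_of_int (3 * (int n)\<^sup>2) \<le> 2 * k"
    using assms by (simp add: power_divide)
  note sub = root_solutions_subset_F3_ball[OF this]
  have "(sqrt k / 6)\<^sup>2 \<le> (real n)\<^sup>2" using n(2) assms by (intro power_mono) auto
  then have "k / 144 \<le> (real n)\<^sup>2 / 4" using assms by (simp add: power_divide)
  also have "\<dots> \<le> real (card (coprime_pairs n))" by (rule card_coprime_pairs_ge) fact
  also have "card (coprime_pairs n) \<le> 2 * card (F3_ball k)"
  proof -
    note card_coprime_pairs_le
    also note card_roots_upto_le_solutions
    also have "card (root_solution ` roots_upto (3 * (int n)\<^sup>2)) \<le> card (F3_ball k)"
      by (rule card_mono[OF finite_F3_ball sub])
    finally show ?thesis by simp
  qed
  finally show ?thesis by simp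
qed

section \<open>Reflection and the count of all solutions\<close>

lemma S3_ball_subset: "S3_ball k \<subseteq> F3_ball k \<union> image_mset (\<lambda>x. - 1 - x) ` F3_ball k"
proof
  fix M assume "M \<in> S3_ball k"
  then have M: "M \<in> S3" "euclidean_norm M \<le> k" by (auto simp: S3_ball_def)
  let ?N = "image_mset (\<lambda>x. - 1 - x) M"
  from S3_cases[OF M(1)] show "M \<in> F3_ball k \<union> image_mset (\<lambda>x. - 1 - x) ` F3_ball k"
  proof
    assume "M \<in> F3"
    then show ?thesis using M by (simp add: F3_ball_def)
  next
    assume *: "?N \<in> F3 \<and> (\<forall>x\<in>#M. x < 0)"
    \<comment> \<open>For negative \<open>x\<close> the reflected value has absolute value
      \<open>\<bar>x\<bar> - 1\<close>, so reflection into the non-negative solutions does not leave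
      the ball.\<close>
    have "(real_of_int (- 1 - x))\<^sup>2 \<le> (real_of_int x)\<^sup>2" if "x \<in># M" for x
    proof -
      have "\<bar>real_of_int (- 1 - x)\<bar> \<le> \<bar>real_of_int x\<bar>" using * that by force
      then show ?thesis by (rule abs_le_square_iff[THEN iffD1])
    qed
    then have "euclidean_norm ?N \<le> euclidean_norm M"
      unfolding euclidean_norm_def
      by (auto simp: multiset.map_comp o_def intro!: sum_mset_mono)
    with * M have "?N \<in> F3_ball k" by (simp add: F3_ball_def)
    moreover have "M = image_mset (\<lambda>x. - 1 - x) ?N" by (simp add: multiset.map_comp o_def)
    ultimately show ?thesis by blast
  qed
qed

lemma finite_S3_ball: "finite (S3_ball k)"
  by (rule finite_subset[OF S3_ball_subset]) (simp add: finite_F3_ball)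

lemma card_S3_ball_le: "card (S3_ball k) \<le> 2 * card (F3_ball k)"
proof -
  have "card (S3_ball k) \<le> card (F3_ball k \<union> image_mset (\<lambda>x. - 1 - x) ` F3_ball k)"
    by (intro card_mono S3_ball_subset) (simp add: finite_F3_ball)
  also have "\<dots> \<le> card (F3_ball k) + card (image_mset (\<lambda>x. - 1 - x) ` F3_ball k)"
    by (rule card_Un_le)
  also have "\<dots> \<le> card (F3_ball k) + card (F3_ball k)"
    by (intro add_left_mono card_image_le finite_F3_ball)
  finally show ?thesis by simp
qed

lemma card_F3_ball_le_S3_ball: "card (F3_ball k) \<le> card (S3_ball k)"
  by (intro card_mono finite_S3_ball) (auto simp: F3_ball_def S3_ball_def F3_def)

section \<open>Linear growth\<close>

lemma bigtheta_of_linear_bounds: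
  fixes f :: "real \<Rightarrow> real"
  assumes "0 < c1" "0 < c2" "\<forall>\<^sub>F k in at_top. c1 * k \<le> f k \<and> f k \<le> c2 * k"
  shows "f \<in> \<Theta>[at_top](\<lambda>k. k)"
proof (rule bigthetaI)
  \<comment> \<open>Landau symbols compare absolute values; restricting to \<open>0 \<le> k\<close>
    makes both functions non-negative.\<close>
  have ev: "\<forall>\<^sub>F k in at_top. 0 \<le> k \<and> c1 * k \<le> f k \<and> f k \<le> c2 * k"
    using eventually_ge_at_top[of 0] assms(3) by eventually_elim simp
  have nonneg: "0 \<le> f k" if "0 \<le> k \<and> c1 * k \<le> f k \<and> f k \<le> c2 * k" for k
    using that assms(1) by (meson mult_nonneg_nonneg less_imp_le order_trans)
  show "f \<in> O(\<lambda>k. k)"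
    by (rule bigoI[of _ c2], rule eventually_mono[OF ev]) (use nonneg in auto)
  show "f \<in> \<Omega>(\<lambda>k. k)"
    by (rule landau_omega.bigI[OF assms(1)], rule eventually_mono[OF ev]) (use nonneg in auto)
qed

theorem theorem6p3:
  shows "(\<exists>c1 > 0. \<exists>c2 > 0. \<forall>\<^sub>F k :: real in at_top.
            c1 * k \<le> real (card (S3_ball k)) \<and> real (card (S3_ball k)) \<le> c2 * k)
       \<and> (\<lambda>k :: real. real (card (S3_ball k))) \<in> \<Theta>[at_top](\<lambda>k. k)
       \<and> (\<exists>c1 > 0. \<exists>c2 > 0. \<forall>\<^sub>F k :: real in at_top.
            c1 * k \<le> real (card (F3_ball k)) \<and> real (card (F3_ball k)) \<le> c2 * k)
       \<and> (\<lambda>k :: real. real (card (F3_ball k))) \<in> \<Theta>[at_top](\<lambda>k. k)"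
proof -
  have bounds: "\<forall>\<^sub>F k in at_top. 1 / 288 * k \<le> real (card (F3_ball k))
      \<and> real (card (F3_ball k)) \<le> 25 * k"
    using eventually_ge_at_top[of 81]
  proof eventually_elim
    case (elim k)
    then show ?case using card_F3_ball_ge[of k] card_F3_ball_le[of k] by simp
  qed
  then have bounds': "\<forall>\<^sub>F k in at_top. 1 / 288 * k \<le> real (card (S3_ball k))
      \<and> real (card (S3_ball k)) \<le> 50 * k"
  proof eventually_elim
    case (elim k)
    then show ?case using card_S3_ball_le[of k] card_F3_ball_le_S3_ball[of k] by linarith
  qed
  have pos: "0 < (1 / 288 :: real)" "0 < (25 :: real)" "0 < (50 :: real)" by simp_all
  show ?thesis
    using bigtheta_of_linear_bounds[OF pos(1,2) bounds] bigtheta_of_linear_bounds[OF pos(1,3) bounds']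
      bounds bounds' pos by blast
qed

end
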